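(* Every mixed strategy $\mu$ is equivalent to a mixed strategy supported on at most four points. Those four points can be taken to form an orthonormal basis for $\mathbb{R}^4$.
   Context: A mixed strategy is a probability measure on the set of unit quaternions, identified with the unit sphere $S^3\subset\mathbb{R}^4$. For a quaternion $p$ write $p=\pi_1(p)+\pi_2(p)i+\pi_3(p)j+\pi_4(p)k$ with $\pi_t(p)\in\mathbb{R}$. Two mixed strategies $\mu,\mu'$ are equivalent if $$\int\pi_t(pq)^2\,d\mu(q)=\int\pi_t(pq)^2\,d\mu'(q)$$ for all unit quaternions $p$ and all $t=1,2,3,4$. Orthonormality is with respect to the standard inner product on $\mathbb{R}^4$. The second sentence means: there is an orthonormal basis $\{q_1,q_2,q_3,q_4\}$ of $\mathbb{R}^4$ such that $\mu$ is equivalent to a mixed strategy assigning all its mass to $\{q_1,q_2,q_3,q_4\}$ (some masses may be zero). *)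

theory Defs
  imports "HOL-Analysis.Analysis" "HOL-Probability.Probability"
begin

text \<open>
  The quaternion \<open>p\<close> with coordinates \<open>\<pi>\<^sub>t(p)\<close> is the vector with \<open>p $ t = \<pi>\<^sub>t(p)\<close>,
  so that \<open>p = p$1 + (p$2) i + (p$3) j + (p$4) k\<close>.  The index type \<open>4\<close> has exactly the
  elements \<open>1, 2, 3, 4\<close> (its numeral \<open>4\<close> coincides with \<open>0\<close>).
\<close>

type_synonym quat = "real ^ 4"

definition qmult :: "quat \<Rightarrow> quat \<Rightarrow> quat" (infixl "\<otimes>\<^sub>q" 70) where
  "p \<otimes>\<^sub>q q = vector
     [p$1 * q$1 - p$2 * q$2 - p$3 * q$3 - p$4 * q$4,
      p$1 * q$2 + p$2 * q$1 + p$3 * q$4 - p$4 * q$3,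
      p$1 * q$3 - p$2 * q$4 + p$3 * q$1 + p$4 * q$2,
      p$1 * q$4 + p$2 * q$3 - p$3 * q$2 + p$4 * q$1]"

lemma vector_4_nth [simp]:
  "(vector [a, b, c, d] :: 'a::zero ^ 4) $ 1 = a"
  "(vector [a, b, c, d] :: 'a ^ 4) $ 2 = b"
  "(vector [a, b, c, d] :: 'a ^ 4) $ 3 = c"
  "(vector [a, b, c, d] :: 'a ^ 4) $ 4 = d"
  by (simp_all add: vector_def)

lemma qmult_units:
  fixes i j k :: quat
  defines "i \<equiv> axis 2 1" and "j \<equiv> axis 3 1" and "k \<equiv> axis 4 1"
  shows "i \<otimes>\<^sub>q i = - axis 1 1" "j \<otimes>\<^sub>q j = - axis 1 1" "k \<otimes>\<^sub>q k = - axis 1 1"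
    and "i \<otimes>\<^sub>q j = k" "j \<otimes>\<^sub>q k = i" "k \<otimes>\<^sub>q i = j"
    and "j \<otimes>\<^sub>q i = - k" "k \<otimes>\<^sub>q j = - i" "i \<otimes>\<^sub>q k = - j"
    and "axis 1 1 \<otimes>\<^sub>q p = p" "p \<otimes>\<^sub>q axis 1 1 = p"
  unfolding i_def j_def k_def
  by (simp_all add: vec_eq_iff forall_4 qmult_def axis_def)

abbreviation unit_quats :: "quat set" where
  "unit_quats \<equiv> sphere 0 1"

definition mixed_strategy :: "quat measure \<Rightarrow> bool" where
  "mixed_strategy \<mu> \<longleftrightarrow> prob_space \<mu> \<and> sets \<mu> = sets (restrict_space borel unit_quats)"

text \<open>
  For mixed strategies the integrands below are bounded and continuous on the sphere, so the
  Bochner integrals are genuine.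
\<close>

definition equivalent_strategies :: "quat measure \<Rightarrow> quat measure \<Rightarrow> bool" where
  "equivalent_strategies \<mu> \<mu>' \<longleftrightarrow>
     (\<forall>p\<in>unit_quats. \<forall>t.
        (\<integral>q. ((p \<otimes>\<^sub>q q) $ t)\<^sup>2 \<partial>\<mu>) = (\<integral>q. ((p \<otimes>\<^sub>q q) $ t)\<^sup>2 \<partial>\<mu>'))"

text \<open>
  All the mass lies on the finite set \<open>S\<close>; points of \<open>S\<close> may have mass zero.
\<close>

definition concentrated_on :: "quat measure \<Rightarrow> quat set \<Rightarrow> bool" where
  "concentrated_on \<mu> S \<longleftrightarrow> finite S \<and> S \<subseteq> unit_quats \<and> measure \<mu> S = 1"

definition orthonormal_basis :: "'a::euclidean_space set \<Rightarrow> bool" where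
  "orthonormal_basis B \<longleftrightarrow>
     pairwise orthogonal B \<and> (\<forall>b\<in>B. norm b = 1) \<and> independent B \<and> span B = UNIV"

end

(* The map q \<mapsto> (p \<otimes>\<^sub>q q) $ t is linear, so a mixed strategy is determined up to equivalence by
   its second moment form h x y = \<integral>(x \<bullet> q)(y \<bullet> q), a positive semidefinite symmetric bilinear form
   of trace 1.  An orthonormal basis diagonalising h, weighted by the diagonal values of h, has the
   same second moment form. *)

theory Submission
  imports Defs
begin

section \<open>Diagonalising a symmetric bilinear form\<close>

text \<open>Near \<open>t = 0\<close> a nonzero linear term dominates a quadratic one. This is the
  first-order condition at a maximum, phrased without derivatives.\<close>

lemma linear_le_quadratic_imp_zero:
  fixes a c :: real
  assumes "\<And>t. 2 * t * a \<le> t\<^sup>2 * c"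
  shows "a = 0"
proof (rule ccontr)
  assume a: "a \<noteq> 0"
  \<comment> \<open>The bound is tested at \<open>t = a / C\<close>, which yields
    \<open>2 * C \<le> c\<close>, impossible as \<open>0 < C\<close> and \<open>c < C\<close>.
    Adding 1 keeps \<open>C\<close> positive when \<open>c = 0\<close>.\<close>
  define C where "C = \<bar>c\<bar> + 1"
  have C: "C > 0" "c < C" by (auto simp: C_def)
  have "2 * (a / C) * a * C\<^sup>2 \<le> (a / C)\<^sup>2 * c * C\<^sup>2"
    by (intro mult_right_mono assms) auto
  then have "a\<^sup>2 * (2 * C) \<le> a\<^sup>2 * c"
    using C by (simp add: power2_eq_square field_simps)
  then show False
    using a C by (simp add: mult_le_cancel_left_pos)
qed

text \<open>Moving from \<open>x\<close> to \<open>x + t *\<^sub>R y\<close> changes the norm only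
  to second order in \<open>t\<close>, so at a maximum the first-order change
  \<open>2 * t * h x y\<close> of the form has to vanish.\<close>

lemma maximiser_conjugate_to_complement:
  fixes h :: "'a::euclidean_space \<Rightarrow> 'a \<Rightarrow> real"
  assumes bil: "bilinear h" and sym: "\<And>x y. h x y = h y x"
    and S: "subspace S" and x: "x \<in> S" "norm x = 1"
    and max: "\<And>y. y \<in> S \<Longrightarrow> norm y = 1 \<Longrightarrow> h y y \<le> h x x"
    and y: "y \<in> S" "x \<bullet> y = 0"
  shows "h x y = 0"
proof (rule linear_le_quadratic_imp_zero)
  \<comment> \<open>Homogeneity extends the maximality of \<open>x\<close> from unit vectors to all
    of \<open>S\<close>, so the perturbed vector need not be normalised.\<close>
  have bound: "h z z \<le> h x x * (z \<bullet> z)" if "z \<in> S" for z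
  proof (cases "z = 0")
    case True
    then show ?thesis using bil by (simp add: bilinear_lzero)
  next
    case False
    let ?u = "(1 / norm z) *\<^sub>R z"
    have "h ?u ?u \<le> h x x"
      using False that S by (intro max) (auto simp: subspace_scale)
    then show ?thesis
      using False bil
      by (simp add: bilinear_lmul bilinear_rmul dot_square_norm power2_eq_square field_simps)
  qed
  have "x \<bullet> x = 1" using x by (simp add: dot_square_norm)
  fix t :: real
  have "x + t *\<^sub>R y \<in> S"
    using S x y by (simp add: subspace_add subspace_scale)
  \<comment> \<open>Orthogonality gives \<open>x + t *\<^sub>R y\<close> the squared norm
    \<open>1 + t\<^sup>2 * (y \<bullet> y)\<close>; the constant terms \<open>h x x\<close> on both
    sides cancel.\<close>
  from bound[OF this] show "2 * t * h x y \<le> t\<^sup>2 * (h x x * (y \<bullet> y) - h y y)"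
    using \<open>x \<bullet> x = 1\<close> y bil sym[of y x]
    by (simp add: bilinear_ladd bilinear_radd bilinear_lmul bilinear_rmul inner_add_left
        inner_add_right inner_commute power2_eq_square algebra_simps)
qed

text \<open>This is the spectral theorem in the language of forms, by induction on dimension: a
  maximiser of \<open>h x x\<close> on the unit sphere of \<open>S\<close> is split off, and its
  orthogonal complement inside \<open>S\<close> is diagonalised. A general subspace \<open>S\<close>
  lets the induction stay inside one type.\<close>

theorem symmetric_bilinear_diagonalisable:
  fixes h :: "'a::euclidean_space \<Rightarrow> 'a \<Rightarrow> real"
  assumes bil: "bilinear h" and sym: "\<And>x y. h x y = h y x" and "subspace S"
  shows "\<exists>B. finite B \<and> B \<subseteq> S \<and> pairwise orthogonal B \<and> (\<forall>b\<in>B. norm b = 1) \<and>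
             span B = S \<and> pairwise (\<lambda>b c. h b c = 0) B"
  using \<open>subspace S\<close>
proof (induction "dim S" arbitrary: S rule: less_induct)
  case less
  note S = \<open>subspace S\<close>
  show ?case
  proof (cases "S = {0}")
    case True
    then show ?thesis by (intro exI[of _ "{}"]) auto
  next
    case False
    then obtain z where z: "z \<in> S" "z \<noteq> 0"
      using S subspace_0 by blast
    let ?K = "S \<inter> sphere 0 1"
    have "compact ?K"
      using S by (simp add: closed_Int_compact closed_subspace)
    moreover have "(1 / norm z) *\<^sub>R z \<in> ?K"
      using z S by (simp add: subspace_scale)
    \<comment> \<open>In finite dimension bilinear maps are bounded, hence continuous.\<close>
    moreover have "continuous_on ?K (\<lambda>x. h x x)"
      using bil unfolding bilinear_conv_bounded_bilinear
      by (intro bounded_bilinear.continuous_on[where prod = h] continuous_intros)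
    ultimately obtain x where x: "x \<in> ?K" and max: "\<forall>y\<in>?K. h y y \<le> h x x"
      using continuous_attains_sup[of ?K "\<lambda>x. h x x"] by blast
    have xS: "x \<in> S" "norm x = 1" using x by auto
    define T where "T = {y \<in> S. x \<bullet> y = 0}"
    have T: "subspace T"
      using S by (auto simp: T_def subspace_def inner_add_right)
    have "x \<notin> T" using xS by (auto simp: T_def)
    then have "T \<subset> S" using xS T_def by blast
    then have "dim T < dim S"
      using S T by (metis dim_psubset span_eq_iff)
    from less.hyps[OF this T] obtain B where B: "finite B" "B \<subseteq> T" "pairwise orthogonal B"
      "\<forall>b\<in>B. norm b = 1" "span B = T" "pairwise (\<lambda>b c. h b c = 0) B"
      by blast
    have conj: "h x y = 0" "h y x = 0" if "y \<in> T" for y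
    proof -
      show "h x y = 0"
        using maximiser_conjugate_to_complement[OF bil sym S xS, of y] max that
        by (simp add: T_def)
      then show "h y x = 0" using sym by metis
    qed
    have "S \<subseteq> span (insert x B)"
    proof
      fix y assume "y \<in> S"
      \<comment> \<open>Subtracting the projection of \<open>y\<close> onto \<open>x\<close> leaves
        a vector of \<open>T = span B\<close>.\<close>
      then have "y - (x \<bullet> y) *\<^sub>R x \<in> T"
        using S xS by (simp add: T_def subspace_diff subspace_scale inner_diff_right dot_square_norm)
      then show "y \<in> span (insert x B)"
        using B span_breakdown_eq by blast
    qed
    moreover have "span (insert x B) \<subseteq> S"
      using S xS B \<open>T \<subset> S\<close> by (intro span_minimal) auto
    moreover have "pairwise orthogonal (insert x B)"
      using B by (auto simp: pairwise_insert orthogonal_def T_def inner_commute)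
    moreover have "pairwise (\<lambda>b c. h b c = 0) (insert x B)"
      using B conj by (auto simp: pairwise_insert)
    ultimately show ?thesis
      using B xS \<open>T \<subset> S\<close> by (intro exI[of _ "insert x B"]) auto
  qed
qed

lemma orthonormal_diagonalising_basis:
  fixes h :: "'a::euclidean_space \<Rightarrow> 'a \<Rightarrow> real"
  assumes "bilinear h" "\<And>x y. h x y = h y x"
  obtains B where "orthonormal_basis B" "pairwise (\<lambda>b c. h b c = 0) B"
proof -
  obtain B where B: "pairwise orthogonal B" "\<forall>b\<in>B. norm b = 1" "span B = UNIV"
      "pairwise (\<lambda>b c. h b c = 0) B"
    using symmetric_bilinear_diagonalisable[OF assms, of UNIV] by auto
  moreover have "independent B"
    using B by (intro pairwise_orthogonal_independent) auto
  ultimately show thesis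
    using that by (simp add: orthonormal_basis_def)
qed

section \<open>Coordinates in an orthonormal basis\<close>

context
  fixes B :: "'a::euclidean_space set"
  assumes B: "orthonormal_basis B"
begin

lemma orthonormal_basis_finite: "finite B"
  using B independent_bound by (auto simp: orthonormal_basis_def)

lemma orthonormal_basis_card: "card B = DIM('a)"
  using B basis_card_eq_dim[of B UNIV] by (simp add: orthonormal_basis_def)

lemma orthonormal_basis_expansion: "(\<Sum>b\<in>B. (x \<bullet> b) *\<^sub>R b) = x"
  using B orthonormal_basis_finite
  by (intro orthonormal_basis_expand) (auto simp: orthonormal_basis_def)

lemma orthonormal_basis_parseval: "(\<Sum>b\<in>B. (x \<bullet> b)\<^sup>2) = (norm x)\<^sup>2"
proof -
  have "x \<bullet> x = (\<Sum>b\<in>B. (x \<bullet> b) *\<^sub>R b) \<bullet> x"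
    by (simp only: orthonormal_basis_expansion)
  also have "\<dots> = (\<Sum>b\<in>B. (x \<bullet> b)\<^sup>2)"
    by (simp add: inner_sum_left power2_eq_square) (simp add: inner_commute)
  finally show ?thesis
    by (simp add: power2_norm_eq_inner)
qed

text \<open>Expanding both arguments in \<open>B\<close> gives a double sum in which only the
  diagonal terms survive.\<close>

lemma diagonal_form_expansion:
  assumes bil: "bilinear h" and diag: "pairwise (\<lambda>b c. h b c = 0) B"
  shows "h x x = (\<Sum>b\<in>B. (x \<bullet> b)\<^sup>2 * (h b b :: real))"
proof -
  have lin: "linear (\<lambda>y. h y z)" "linear (h z)" for z
    using bil by (auto simp: bilinear_def)
  have "h x x = h (\<Sum>b\<in>B. (x \<bullet> b) *\<^sub>R b) (\<Sum>b\<in>B. (x \<bullet> b) *\<^sub>R b)"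
    by (simp only: orthonormal_basis_expansion)
  also have "\<dots> = (\<Sum>b\<in>B. \<Sum>c\<in>B. (x \<bullet> b) * ((x \<bullet> c) * h c b))"
    by (simp add: linear_sum[OF lin(1)] linear_sum[OF lin(2)] bilinear_lmul[OF bil]
        bilinear_rmul[OF bil] sum_distrib_left)
  also have "\<dots> = (\<Sum>b\<in>B. \<Sum>c\<in>B. if c = b then (x \<bullet> b)\<^sup>2 * h b b else 0)"
    using diag by (intro sum.cong refl) (auto simp: pairwise_def power2_eq_square)
  finally show ?thesis
    by (simp add: orthonormal_basis_finite)
qed

end

section \<open>Second moments of mixed strategies\<close>

text \<open>Each coordinate of the product is a linear functional of \<open>q\<close>, so it has a
  representing vector. This turns the integrals that define equivalence into values
  \<open>second_moment \<mu> v v\<close>.\<close>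

lemma qmult_component_inner: "\<exists>v. \<forall>q. (p \<otimes>\<^sub>q q) $ t = v \<bullet> q"
proof -
  have "linear (\<lambda>q. (p \<otimes>\<^sub>q q) $ t)"
    using exhaust_4[of t]
    by (intro linearI) (auto simp: qmult_def algebra_simps)
  then show ?thesis
    \<comment> \<open>The representing vector is the adjoint of the functional, a map from the
      reals, applied to 1.\<close>
    using adjoint_works[of "\<lambda>q. (p \<otimes>\<^sub>q q) $ t" _ 1]
    by (intro exI[of _ "adjoint (\<lambda>q. (p \<otimes>\<^sub>q q) $ t) 1"]) (simp add: inner_commute)
qed

lemma mixed_strategyD:
  assumes "mixed_strategy \<mu>"
  shows "prob_space \<mu>" "sets \<mu> = sets (restrict_space borel unit_quats)" "space \<mu> = unit_quats"
  using assms sets_eq_imp_space_eq[of \<mu> "restrict_space borel unit_quats"]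
  by (auto simp: mixed_strategy_def space_restrict_space)

lemma mixed_strategy_measurable:
  assumes "mixed_strategy \<mu>" "f \<in> borel_measurable borel"
  shows "f \<in> borel_measurable \<mu>"
  by (subst measurable_cong_sets[OF mixed_strategyD(2)[OF assms(1)] refl])
    (rule measurable_restrict_space1[OF assms(2)])

definition second_moment :: "quat measure \<Rightarrow> quat \<Rightarrow> quat \<Rightarrow> real" where
  "second_moment \<mu> x y = (\<integral>q. (x \<bullet> q) * (y \<bullet> q) \<partial>\<mu>)"

text \<open>On the unit sphere Cauchy-Schwarz bounds the integrand by a constant, which is
  integrable for a probability measure.\<close>

lemma second_moment_integrable:
  assumes "mixed_strategy \<mu>"
  shows "integrable \<mu> (\<lambda>q. (x \<bullet> q) * (y \<bullet> q))"
proof -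
  interpret prob_space \<mu> using mixed_strategyD(1)[OF assms] .
  have "\<bar>x \<bullet> q\<bar> * \<bar>y \<bullet> q\<bar> \<le> norm x * norm y" if "q \<in> space \<mu>" for q
    using that Cauchy_Schwarz_ineq2[of x q] Cauchy_Schwarz_ineq2[of y q]
    by (intro mult_mono) (auto simp: mixed_strategyD(3)[OF assms])
  then show ?thesis
    by (intro integrable_const_bound[where B = "norm x * norm y"]
        mixed_strategy_measurable[OF assms]) (auto simp: abs_mult)
qed

lemma second_moment_sym: "second_moment \<mu> x y = second_moment \<mu> y x"
  by (simp add: second_moment_def mult.commute)

lemma second_moment_bilinear:
  assumes "mixed_strategy \<mu>"
  shows "bilinear (second_moment \<mu>)"
proof -
  have lin: "linear (\<lambda>x. second_moment \<mu> x y)" for y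
    by (intro linearI)
      (simp_all add: second_moment_def inner_add_left distrib_right mult.assoc
        second_moment_integrable[OF assms])
  then show ?thesis
    unfolding bilinear_def
    \<comment> \<open>Symmetry carries linearity over from the first argument to the second.\<close>
    using back_subst[of linear, OF lin ext[OF second_moment_sym]] by blast
qed

text \<open>By Parseval the summed integrand is the squared norm of \<open>q\<close>, which is 1 on
  the sphere. Hence the diagonal values can serve as probabilities.\<close>

lemma second_moment_trace:
  assumes "mixed_strategy \<mu>" and B: "orthonormal_basis B"
  shows "(\<Sum>b\<in>B. second_moment \<mu> b b) = 1"
proof -
  interpret prob_space \<mu> using mixed_strategyD(1)[OF assms(1)] .
  have "(\<Sum>b\<in>B. second_moment \<mu> b b) = (\<integral>q. (\<Sum>b\<in>B. (b \<bullet> q) * (b \<bullet> q)) \<partial>\<mu>)"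
    using second_moment_integrable[OF assms(1)] by (simp add: second_moment_def)
  also have "\<dots> = (\<integral>q. 1 \<partial>\<mu>)"
    using orthonormal_basis_parseval[OF B] mixed_strategyD(3)[OF assms(1)]
    by (intro Bochner_Integration.integral_cong refl)
      (simp add: power2_eq_square inner_commute)
  finally show ?thesis by (simp add: prob_space)
qed

lemma equivalent_strategiesI:
  assumes "\<And>v. second_moment \<mu> v v = second_moment \<nu> v v"
  shows "equivalent_strategies \<mu> \<nu>"
  unfolding equivalent_strategies_def
proof (intro ballI allI)
  fix p t
  obtain v where "\<And>q. (p \<otimes>\<^sub>q q) $ t = v \<bullet> q"
    using qmult_component_inner by metis
  then show "(\<integral>q. ((p \<otimes>\<^sub>q q) $ t)\<^sup>2 \<partial>\<mu>) = (\<integral>q. ((p \<otimes>\<^sub>q q) $ t)\<^sup>2 \<partial>\<nu>)"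
    using assms[of v] by (simp add: second_moment_def power2_eq_square)
qed

section \<open>Strategies with finite support\<close>

lemma finitely_supported_strategy:
  assumes B: "finite B" "B \<subseteq> unit_quats"
    and w: "\<And>b. b \<in> B \<Longrightarrow> 0 \<le> w b" "sum w B = 1"
  obtains \<nu> where "mixed_strategy \<nu>" "concentrated_on \<nu> B"
    "\<And>x y. second_moment \<nu> x y = (\<Sum>b\<in>B. w b * ((x \<bullet> b) * (y \<bullet> b)))"
proof -
  define P where "P = point_measure B (\<lambda>b. ennreal (w b))"
  \<comment> \<open>Pushing forward along the identity changes only the underlying space: from
    \<open>B\<close> with all its subsets to the sphere with its Borel sets.\<close>
  define \<nu> where "\<nu> = distr P (restrict_space borel unit_quats) (\<lambda>q. q)"
  have meas: "(\<lambda>q. q) \<in> measurable P (restrict_space borel unit_quats)"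
    using B by (auto simp: P_def space_restrict_space)
  have eP: "emeasure P B = 1"
    using B w by (simp add: P_def emeasure_point_measure_finite sum_ennreal)
  interpret P: prob_space P
    using eP by (intro prob_spaceI) (simp add: P_def space_point_measure)
  have "mixed_strategy \<nu>"
    using P.prob_space_distr[OF meas] by (simp add: mixed_strategy_def \<nu>_def)
  moreover have "concentrated_on \<nu> B"
  proof -
    have "B \<in> sets (restrict_space borel unit_quats)"
      using B by (auto simp: sets_restrict_space_iff finite_imp_closed)
    then have "measure \<nu> B = measure P (B \<inter> space P)"
      using meas by (simp add: \<nu>_def measure_distr)
    also have "\<dots> = 1"
      using eP by (simp add: P_def space_point_measure measure_def)
    finally show ?thesis using B by (simp add: concentrated_on_def)
  qed
  moreover have "second_moment \<nu> x y = (\<Sum>b\<in>B. w b * ((x \<bullet> b) * (y \<bullet> b)))" for x y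
  proof -
    have "(\<lambda>q. (x \<bullet> q) * (y \<bullet> q)) \<in> borel_measurable (restrict_space borel unit_quats)"
      by (intro measurable_restrict_space1) simp
    then have "second_moment \<nu> x y = (\<integral>q. (x \<bullet> q) * (y \<bullet> q) \<partial>P)"
      using meas by (simp add: second_moment_def \<nu>_def integral_distr)
    also have "\<dots> = (\<Sum>b\<in>B. w b * ((x \<bullet> b) * (y \<bullet> b)))"
      using B w by (simp add: P_def lebesgue_integral_point_measure_finite)
    finally show ?thesis .
  qed
  ultimately show thesis by (rule that)
qed

theorem theorem2p1:
  fixes \<mu> :: "quat measure"
  assumes "mixed_strategy \<mu>"
  shows "(\<exists>\<nu> S. mixed_strategy \<nu> \<and> equivalent_strategies \<mu> \<nu> \<and>
            concentrated_on \<nu> S \<and> card S \<le> 4) \<and>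
         (\<exists>\<nu> B. mixed_strategy \<nu> \<and> equivalent_strategies \<mu> \<nu> \<and>
            concentrated_on \<nu> B \<and> card B = 4 \<and> orthonormal_basis B)"
proof -
  let ?h = "second_moment \<mu>"
  have bil: "bilinear ?h"
    using assms by (rule second_moment_bilinear)
  obtain B where B: "orthonormal_basis B" and diag: "pairwise (\<lambda>b c. ?h b c = 0) B"
    using orthonormal_diagonalising_basis[OF bil second_moment_sym] .
  have "B \<subseteq> unit_quats"
    using B by (auto simp: orthonormal_basis_def)
  moreover have "0 \<le> ?h b b" for b
    by (simp add: second_moment_def)
  \<comment> \<open>The point \<open>b\<close> receives mass \<open>?h b b\<close>, nonnegative as
    the integral of a square; the masses add up to the trace, which is 1.\<close>
  ultimately obtain \<nu> where \<nu>: "mixed_strategy \<nu>" "concentrated_on \<nu> B"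
    and moment: "\<And>x y. second_moment \<nu> x y = (\<Sum>b\<in>B. ?h b b * ((x \<bullet> b) * (y \<bullet> b)))"
    using finitely_supported_strategy[of B "\<lambda>b. ?h b b"] orthonormal_basis_finite[OF B]
      second_moment_trace[OF assms B] by blast
  have "equivalent_strategies \<mu> \<nu>"
  proof (rule equivalent_strategiesI)
    fix v
    have "?h v v = (\<Sum>b\<in>B. (v \<bullet> b)\<^sup>2 * ?h b b)"
      using B bil diag by (rule diagonal_form_expansion)
    then show "?h v v = second_moment \<nu> v v"
      by (simp only: moment power2_eq_square mult.commute)
  qed
  moreover have "card B = 4"
    using orthonormal_basis_card[OF B] by simp
  ultimately show ?thesis
    \<comment> \<open>The same \<open>\<nu>\<close> and \<open>B\<close> witness both
      claims.\<close>
    using \<nu> B by (intro conjI exI[of _ \<nu>] exI[of _ B]) auto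
qed

end
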